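(* Let $G$ be a locally finite group which is either an $FC$-group or quasihamiltonian. Then for every endomorphism $\phi$ of $G$ and every $\phi$-invariant normal subgroup $H$ of $G$ one has $$h(\phi)=h(\phi\restriction_H)+h(\bar\phi_{G/H}),$$ where $\phi\restriction_H\in\mathrm{End}(H)$ is the restriction of $\phi$ to $H$ and $\bar\phi_{G/H}\in\mathrm{End}(G/H)$ is the endomorphism induced by $\phi$.
   Context: A group is locally finite if each of its finitely generated subgroups is finite. A group is an $FC$-group if each of its elements has only finitely many conjugates. A group $G$ is quasihamiltonian if $HK=KH$ for all subgroups $H,K$ of $G$, where products of subsets are setwise: $XY=\{xy\mid x\in X,\ y\in Y\}$. Algebraic entropy: for a group $G$, let $\mathcal P_{fin}(G)$ be the set of all finite non-empty subsets of $G$. For $\phi\in\mathrm{End}(G)$ and $X\in\mathcal P_{fin}(G)$, let $T_0(\phi,X)=\{1\}$ and $T_n(\phi,X)=X\phi(X)\phi^2(X)\cdots\phi^{n-1}(X)$ for $n\geq 1$. The limit $H(\phi,X)=\lim_{n\to\infty}\frac{\log|T_n(\phi,X)|}{n}$ exists and is finite. The algebraic entropy of $\phi$ is $h(\phi)=\sup\{H(\phi,X)\mid X\in\mathcal P_{fin}(G)\}\in[0,\infty]$ (with the usual convention $a+\infty=\infty$ for sums in $[0,\infty]$). A subgroup $H$ of $G$ is $\phi$-invariant if $\phi(H)\subseteq H$. *)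

theory Defs
  imports
    Complex_Main
    "HOL-Library.Extended_Nonnegative_Real"
    "HOL-Algebra.Generated_Groups"
begin

definition locally_finite_group :: "('a, 'b) monoid_scheme \<Rightarrow> bool" where
  "locally_finite_group G \<longleftrightarrow>
     group G \<and> (\<forall>S. S \<subseteq> carrier G \<and> finite S \<longrightarrow> finite (generate G S))"

definition FC_group :: "('a, 'b) monoid_scheme \<Rightarrow> bool" where
  "FC_group G \<longleftrightarrow>
     group G \<and>
     (\<forall>x \<in> carrier G. finite {g \<otimes>\<^bsub>G\<^esub> x \<otimes>\<^bsub>G\<^esub> inv\<^bsub>G\<^esub> g | g. g \<in> carrier G})"

definition quasihamiltonian_group :: "('a, 'b) monoid_scheme \<Rightarrow> bool" where
  "quasihamiltonian_group G \<longleftrightarrow>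
     group G \<and>
     (\<forall>H K. subgroup H G \<and> subgroup K G \<longrightarrow> H <#>\<^bsub>G\<^esub> K = K <#>\<^bsub>G\<^esub> H)"

primrec trajectory :: "('a, 'b) monoid_scheme \<Rightarrow> ('a \<Rightarrow> 'a) \<Rightarrow> 'a set \<Rightarrow> nat \<Rightarrow> 'a set" where
  "trajectory G \<phi> X 0 = {\<one>\<^bsub>G\<^esub>}"
| "trajectory G \<phi> X (Suc n) = trajectory G \<phi> X n <#>\<^bsub>G\<^esub> (\<phi> ^^ n) ` X"

definition entropy_wrt :: "('a, 'b) monoid_scheme \<Rightarrow> ('a \<Rightarrow> 'a) \<Rightarrow> 'a set \<Rightarrow> real" where
  "entropy_wrt G \<phi> X = lim (\<lambda>n. ln (real (card (trajectory G \<phi> X n))) / real n)"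

text \<open>For finite non-empty \<open>X \<subseteq> carrier G\<close> and an endomorphism \<open>\<phi>\<close> the trajectories are finite and
  non-empty, so the limit above is non-negative and \<open>ennreal\<close> does not truncate it.\<close>

definition algebraic_entropy :: "('a, 'b) monoid_scheme \<Rightarrow> ('a \<Rightarrow> 'a) \<Rightarrow> ennreal" where
  "algebraic_entropy G \<phi> =
     (SUP X \<in> {X. X \<subseteq> carrier G \<and> finite X \<and> X \<noteq> {}}. ennreal (entropy_wrt G \<phi> X))"

text \<open>The induced map sends the coset of \<open>x\<close> to the coset of \<open>\<phi> x\<close>. The image below is a singleton
  when \<open>C\<close> is a coset of a \<open>\<phi>\<close>-invariant normal subgroup \<open>H\<close>; see \<open>quotient_map_coset\<close>.\<close>

definition quotient_map_by ::
    "('a, 'b) monoid_scheme \<Rightarrow> 'a set \<Rightarrow> ('a \<Rightarrow> 'a) \<Rightarrow> 'a set \<Rightarrow> 'a set" where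
  "quotient_map_by G H \<phi> C = the_elem ((\<lambda>x. H #>\<^bsub>G\<^esub> \<phi> x) ` C)"

lemma quotient_map_coset:
  assumes H: "H \<lhd> G" and \<phi>: "\<phi> \<in> hom G G" and inv: "\<phi> ` H \<subseteq> H" and x: "x \<in> carrier G"
  shows "quotient_map_by G H \<phi> (H #>\<^bsub>G\<^esub> x) = H #>\<^bsub>G\<^esub> \<phi> x"
proof -
  interpret normal H G by (rule H)
  have "(\<lambda>y. H #>\<^bsub>G\<^esub> \<phi> y) ` (H #>\<^bsub>G\<^esub> x) = {H #>\<^bsub>G\<^esub> \<phi> x}"
  proof -
    have "H #>\<^bsub>G\<^esub> \<phi> y = H #>\<^bsub>G\<^esub> \<phi> x" if y: "y \<in> H #>\<^bsub>G\<^esub> x" for y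
    proof -
      obtain h where h: "h \<in> H" "y = h \<otimes>\<^bsub>G\<^esub> x"
        using y by (auto simp: r_coset_def)
      have "\<phi> y = \<phi> h \<otimes>\<^bsub>G\<^esub> \<phi> x"
        using h x \<phi> by (simp add: hom_mult mem_carrier)
      moreover have "\<phi> h \<in> H" using inv h by blast
      moreover have "\<phi> x \<in> carrier G" using \<phi> x by (simp add: hom_in_carrier)
      ultimately show ?thesis
        by (metis coset_join3 coset_mult_assoc coset_mult_inv2 mem_carrier
            subgroup_axioms subset coset_join2)
    qed
    moreover have "x \<in> H #>\<^bsub>G\<^esub> x" using x by (simp add: rcos_self subgroup_axioms)
    ultimately show ?thesis by blast
  qed
  then show ?thesis by (simp add: quotient_map_by_def)
qed

end

theory Submission
  imports Defs "HOL-Algebra.Zassenhaus"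
begin

text \<open>
  Every finite subset of \<open>G\<close> lies in a finite subgroup \<open>F\<close> all of whose trajectories \<open>T\<^sub>n(F)\<close> are
  subgroups: take \<open>F\<close> normal (FC case), respectively any finite subgroup (quasihamiltonian case).
  For such \<open>F\<close> we have \<open>|T\<^sub>n(F)| = |T\<^sub>n(\<pi>F)| |T\<^sub>n(F) \<inter> H|\<close>, where \<open>\<pi>\<close> is the projection to \<open>G/H\<close>.
  As \<open>T\<^sub>n(F \<inter> H) \<subseteq> T\<^sub>n(F) \<inter> H\<close>, the entropy of \<open>G\<close> is at least the sum.
  Conversely, the indices \<open>[T\<^sub>n\<^sub>+\<^sub>1(\<pi>F) : T\<^sub>n(\<pi>F)]\<close> decrease, hence are eventually constant, and from
  then on \<open>T\<^sub>n\<^sub>+\<^sub>1(F) \<inter> H = (T\<^sub>n(F) \<inter> H) \<phi>(T\<^sub>n(F) \<inter> H)\<close>. So for some \<open>M\<close> the group \<open>E = T\<^sub>M(F) \<inter> H\<close>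
  satisfies \<open>T\<^sub>M\<^sub>+\<^sub>k(F) \<inter> H = T\<^sub>k\<^sub>+\<^sub>1(E)\<close> for all \<open>k\<close>, and the entropy of \<open>F\<close> is the sum of
  those of \<open>\<pi>F\<close> and \<open>E\<close>.
\<close>

declare trajectory.simps(2) [simp del]

section \<open>Subadditive and eventually constant sequences\<close>

text \<open>Fekete's lemma, with the infimum of \<open>a n / n\<close> over \<open>n \<ge> 1\<close>
  as the limit. Division with remainder by a fixed \<open>m\<close> bounds \<open>a n\<close> by
  \<open>(n div m) * a m + a (n mod m)\<close>, and only finitely many remainders occur.\<close>

lemma convergent_subadditive:
  fixes a :: "nat \<Rightarrow> real"
  assumes nonneg: "\<And>n. 0 \<le> a n" and sub: "\<And>m n. a (m + n) \<le> a m + a n"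
  shows "convergent (\<lambda>n. a n / n)"
proof -
  define L where "L = (INF n\<in>{1..}. a n / real n)"
  have bdd: "bdd_below ((\<lambda>n. a n / real n) ` {1..})"
    using nonneg by (intro bdd_belowI[of _ 0]) auto
  have mult: "a (q * m + r) \<le> q * a m + a r" for q m r
  proof (induction q)
    case (Suc q)
    have "a (Suc q * m + r) \<le> a m + a (q * m + r)"
      using sub[of m "q * m + r"] by (simp add: add.assoc)
    with Suc show ?case by (simp add: algebra_simps)
  qed simp
  have "(\<lambda>n. a n / n) \<longlonglongrightarrow> L"
  proof (rule LIMSEQ_I)
    fix e :: real assume e: "0 < e"
    obtain m where m: "1 \<le> m" "a m / real m < L + e / 2"
    proof -
      have "\<exists>x\<in>(\<lambda>n. a n / real n) ` {1..}. x < L + e / 2"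
        using e bdd unfolding L_def by (subst cInf_less_iff[symmetric]) auto
      then show ?thesis using that by auto
    qed
    \<comment> \<open>\<open>C\<close> bounds the contribution of the remainder; \<open>n0\<close>
      is then taken so large that \<open>C / n < e / 2\<close> beyond it.\<close>
    define C where "C = Max (a ` {..<m})"
    have C: "a r \<le> C" if "r < m" for r
      using that unfolding C_def by (intro Max_ge) auto
    obtain n0 :: nat where n0: "2 * C / e < n0" using reals_Archimedean2 by blast
    have "norm (a n / n - L) < e" if n: "n \<ge> Suc n0" for n
    proof -
      have n_pos: "0 < n" using n by simp
      have low: "L \<le> a n / n"
        unfolding L_def using bdd n_pos by (intro cINF_lower) auto
      have "a n \<le> (n div m) * a m + a (n mod m)"
        using mult[of "n div m" m "n mod m"] by simp
      also have "a (n mod m) \<le> C" using m by (intro C) simp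
      also have "real (n div m) * a m = (real (n div m) * m) * (a m / m)" using m by simp
      also have "\<dots> \<le> n * (a m / m)"
      proof (intro mult_right_mono)
        show "real (n div m) * real m \<le> real n"
          using div_times_less_eq_dividend[of n m] by (metis of_nat_le_iff of_nat_mult)
      qed (use nonneg in auto)
      finally have "a n / n \<le> (n * (a m / m) + C) / n"
        using n_pos by (simp add: divide_right_mono)
      also have "\<dots> = a m / m + C / n" using n_pos by (simp add: add_divide_distrib)
      also have "C / n < e / 2"
      proof -
        have "2 * C / e < n" using n0 n by linarith
        then show ?thesis using e n_pos by (simp add: field_simps)
      qed
      finally have "a n / n < L + e" using m by linarith
      with low show ?thesis by simp
    qed
    then show "\<exists>no. \<forall>n\<ge>no. norm (a n / n - L) < e" by blast
  qed
  then show ?thesis by (rule convergentI)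
qed

text \<open>Serves to compare trajectories of length \<open>M + k\<close> with trajectories of
  length \<open>k + 1\<close>. The ratio of the two lengths is 1 + (M - 1) / (k + 1), which tends to
  1; \<open>M > 0\<close> keeps \<open>M + k\<close> nonzero at \<open>k = 0\<close>.\<close>

lemma LIMSEQ_divide_shift:
  fixes a :: "nat \<Rightarrow> real"
  assumes "(\<lambda>n. a n / n) \<longlonglongrightarrow> L" and "M > 0"
  shows "(\<lambda>k. a (M + k) / Suc k) \<longlonglongrightarrow> L"
proof -
  have "(\<lambda>k. a (M + k) / (M + k)) \<longlonglongrightarrow> L"
    using LIMSEQ_ignore_initial_segment[OF assms(1), of M] by (simp add: add.commute)
  moreover have "(\<lambda>k. 1 + (real M - 1) / Suc k) \<longlonglongrightarrow> 1 + 0"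
    by (intro tendsto_intros LIMSEQ_Suc lim_const_over_n)
  ultimately have "(\<lambda>k. a (M + k) / (M + k) * (1 + (real M - 1) / Suc k)) \<longlonglongrightarrow> L * (1 + 0)"
    by (rule tendsto_mult)
  moreover have "a (M + k) / (M + k) * (1 + (real M - 1) / Suc k) = a (M + k) / Suc k" for k
  proof -
    have "1 + (real M - 1) / Suc k = (real M + real k) / Suc k" by (simp add: field_simps)
    then show ?thesis using assms(2) by (simp only: of_nat_add) simp
  qed
  ultimately show ?thesis by (simp only: mult_1_right add_0_right)
qed

lemma decseq_nat_stationary:
  fixes a :: "nat \<Rightarrow> nat"
  assumes "decseq a"
  shows "\<exists>N. \<forall>n\<ge>N. a n = a N"
proof -
  define v where "v = (LEAST v. v \<in> range a)"
  have "v \<in> range a" unfolding v_def by (rule LeastI) auto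
  then obtain N where N: "v = a N" by blast
  have "a n = a N" if "n \<ge> N" for n
  proof (rule antisym)
    show "a n \<le> a N" using assms that by (rule decseqD)
    show "a N \<le> a n" unfolding N[symmetric] v_def by (rule Least_le) auto
  qed
  then show ?thesis by blast
qed

section \<open>Setwise products and their cardinalities\<close>

text \<open>The fibre of \<open>(a, b) \<mapsto> a h(b)\<close> over \<open>a h(b)\<close> consists of the pairs \<open>(a h(d)\<^sup>-\<^sup>1, d b)\<close> with
  \<open>h d \<in> A\<close>.\<close>

lemma (in group_hom) card_set_mult_image:
  assumes A: "subgroup A H" "finite A" and B: "subgroup B G" "finite B"
  shows "card (A <#>\<^bsub>H\<^esub> h ` B) * card {b \<in> B. h b \<in> A} = card A * card B"
proof -
  define D where "D = {b \<in> B. h b \<in> A}"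
  define g where "g = (\<lambda>(a, b). a \<otimes>\<^bsub>H\<^esub> h b)"
  have img: "g ` (A \<times> B) = A <#>\<^bsub>H\<^esub> h ` B"
    unfolding g_def set_mult_def by force
  have Acar: "a \<in> A \<Longrightarrow> a \<in> carrier H" for a using A(1) by (rule subgroup.mem_carrier)
  have Bcar: "b \<in> B \<Longrightarrow> b \<in> carrier G" for b using B(1) by (rule subgroup.mem_carrier)
  have Ai: "a \<in> A \<Longrightarrow> inv\<^bsub>H\<^esub> a \<in> A" for a using A(1) by (rule subgroup.m_inv_closed)
  have Am: "a \<in> A \<Longrightarrow> a' \<in> A \<Longrightarrow> a \<otimes>\<^bsub>H\<^esub> a' \<in> A" for a a' using A(1) by (rule subgroup.m_closed)
  have Bi: "b \<in> B \<Longrightarrow> inv b \<in> B" for b using B(1) by (rule subgroup.m_inv_closed)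
  have Bm: "b \<in> B \<Longrightarrow> b' \<in> B \<Longrightarrow> b \<otimes> b' \<in> B" for b b' using B(1) by (rule subgroup.m_closed)
  have fibre: "card {p \<in> A \<times> B. g p = y} = card D" if y: "y \<in> g ` (A \<times> B)" for y
  proof -
    obtain a b where ab: "a \<in> A" "b \<in> B" "y = a \<otimes>\<^bsub>H\<^esub> h b"
      using y unfolding g_def by auto
    have "bij_betw (\<lambda>d. (a \<otimes>\<^bsub>H\<^esub> inv\<^bsub>H\<^esub> (h d), d \<otimes> b)) D {p \<in> A \<times> B. g p = y}"
    proof (rule bij_betw_byWitness[where f' = "\<lambda>p. snd p \<otimes> inv b"])
      show "\<forall>d\<in>D. snd (a \<otimes>\<^bsub>H\<^esub> inv\<^bsub>H\<^esub> h d, d \<otimes> b) \<otimes> inv b = d"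
        using ab Bcar by (auto simp: D_def G.m_assoc)
      show "(\<lambda>d. (a \<otimes>\<^bsub>H\<^esub> inv\<^bsub>H\<^esub> h d, d \<otimes> b)) ` D \<subseteq> {p \<in> A \<times> B. g p = y}"
        using ab Acar Bcar
        by (auto simp: D_def g_def H.m_assoc Am Ai Bm H.inv_solve_left H.inv_solve_left')
      \<comment> \<open>Two representations of \<open>y\<close> differ by an element of
        \<open>B\<close> whose image is a quotient of elements of \<open>A\<close>, that is, by an
        element of \<open>D\<close>. Hence the second coordinate alone determines the pair.\<close>
      have eq: "h (b' \<otimes> inv b) = inv\<^bsub>H\<^esub> a' \<otimes>\<^bsub>H\<^esub> a"
        if "a' \<in> A" "b' \<in> B" "a' \<otimes>\<^bsub>H\<^esub> h b' = a \<otimes>\<^bsub>H\<^esub> h b" for a' b'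
      proof -
        have "h b' = inv\<^bsub>H\<^esub> a' \<otimes>\<^bsub>H\<^esub> (a \<otimes>\<^bsub>H\<^esub> h b)"
          using that ab Acar Bcar by (metis H.inv_solve_left H.m_closed hom_closed)
        then show ?thesis using that ab Acar Bcar by (simp add: H.m_assoc)
      qed
      show "\<forall>p\<in>{p \<in> A \<times> B. g p = y}. (a \<otimes>\<^bsub>H\<^esub> inv\<^bsub>H\<^esub> h (snd p \<otimes> inv b),
          snd p \<otimes> inv b \<otimes> b) = p"
      proof
        fix p assume "p \<in> {p \<in> A \<times> B. g p = y}"
        then obtain a' b' where p: "a' \<in> A" "b' \<in> B" "g (a', b') = y" "p = (a', b')" by auto
        then have "h (b' \<otimes> inv b) = inv\<^bsub>H\<^esub> a' \<otimes>\<^bsub>H\<^esub> a"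
          using ab by (intro eq) (auto simp: g_def)
        then have "a \<otimes>\<^bsub>H\<^esub> inv\<^bsub>H\<^esub> h (b' \<otimes> inv b) = a'"
          using p ab Acar by (simp add: H.inv_mult_group flip: H.m_assoc)
        moreover have "b' \<otimes> inv b \<otimes> b = b'" using p ab Bcar by (simp add: G.m_assoc)
        ultimately show "(a \<otimes>\<^bsub>H\<^esub> inv\<^bsub>H\<^esub> h (snd p \<otimes> inv b), snd p \<otimes> inv b \<otimes> b) = p"
          by (simp add: p(4))
      qed
      show "(\<lambda>p. snd p \<otimes> inv b) ` {p \<in> A \<times> B. g p = y} \<subseteq> D"
        using ab eq by (auto simp: D_def g_def Bm Bi Am Ai simp del: hom_mult)
    qed
    then show ?thesis by (simp add: bij_betw_same_card)
  qed
  \<comment> \<open>Count the pairs fibre by fibre; all fibres have the size of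
    \<open>D\<close>.\<close>
  have "card (A \<times> B) = (\<Sum>p\<in>A \<times> B. 1)" by simp
  also have "\<dots> = (\<Sum>y\<in>g ` (A \<times> B). \<Sum>p\<in>{p \<in> A \<times> B. g p = y}. 1)"
    using A B by (intro sum.image_gen) auto
  also have "\<dots> = card (g ` (A \<times> B)) * card D" by (simp add: fibre)
  finally show ?thesis by (simp add: img D_def card_cartesian_product)
qed

lemma set_multI: "x \<in> A \<Longrightarrow> y \<in> B \<Longrightarrow> x \<otimes>\<^bsub>G\<^esub> y \<in> A <#>\<^bsub>G\<^esub> B"
  unfolding set_mult_def by blast

lemma set_multE:
  assumes "z \<in> A <#>\<^bsub>G\<^esub> B"
  obtains x y where "x \<in> A" "y \<in> B" "z = x \<otimes>\<^bsub>G\<^esub> y"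
  using assms unfolding set_mult_def by blast

lemma finite_set_mult: "finite A \<Longrightarrow> finite B \<Longrightarrow> finite (A <#>\<^bsub>G\<^esub> B)"
  unfolding set_mult_def by auto

lemma card_set_mult_le:
  assumes "finite A" "finite B"
  shows "card (A <#>\<^bsub>G\<^esub> B) \<le> card A * card B"
proof -
  have "A <#>\<^bsub>G\<^esub> B = (\<lambda>(a, b). a \<otimes>\<^bsub>G\<^esub> b) ` (A \<times> B)" unfolding set_mult_def by force
  then show ?thesis
    using card_image_le[of "A \<times> B" "\<lambda>(a, b). a \<otimes>\<^bsub>G\<^esub> b"] assms by (simp add: card_cartesian_product)
qed

lemma (in group) set_mult_subgroup_absorb:
  assumes "subgroup S G" "B \<subseteq> S" "\<one> \<in> B"
  shows "S <#> B = S"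
proof
  show "S <#> B \<subseteq> S" using assms by (auto elim!: set_multE dest: subgroup.m_closed)
  show "S \<subseteq> S <#> B"
  proof
    fix x assume "x \<in> S"
    then show "x \<in> S <#> B"
      using set_multI[of x S \<one> B G] assms by (simp add: subgroup.mem_carrier)
  qed
qed

text \<open>Permutability swaps the middle factors, so ABAB = AABB = AB, and inverses of elements of
  AB lie in BA = AB.\<close>

lemma (in group) subgroup_set_mult_commute:
  assumes A: "subgroup A G" and B: "subgroup B G" and AB: "A <#> B = B <#> A"
  shows "subgroup (A <#> B) G"
proof (rule subgroupI)
  note sub = subgroup.subset[OF A] subgroup.subset[OF B]
  show "A <#> B \<subseteq> carrier G" using sub by (rule set_mult_closed)
  show "A <#> B \<noteq> {}"
    using set_multI[OF subgroup.one_closed[OF A] subgroup.one_closed[OF B]] by blast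
  show "inv z \<in> A <#> B" if "z \<in> A <#> B" for z
  proof -
    obtain x y where xy: "x \<in> A" "y \<in> B" "z = x \<otimes> y" using \<open>z \<in> A <#> B\<close> by (rule set_multE)
    with sub have "inv z = inv y \<otimes> inv x" by (simp add: inv_mult_group subsetD)
    also have "\<dots> \<in> B <#> A" using xy A B by (intro set_multI) (auto simp: subgroup.m_inv_closed)
    finally show ?thesis using AB by simp
  qed
  show "z \<otimes> w \<in> A <#> B" if "z \<in> A <#> B" "w \<in> A <#> B" for z w
  proof -
    have "z \<otimes> w \<in> (A <#> B) <#> (A <#> B)" using that by (rule set_multI)
    also have "\<dots> = (A <#> (B <#> A)) <#> B" using sub by (simp add: set_mult_assoc set_mult_closed)
    also have "\<dots> = (A <#> (A <#> B)) <#> B" using AB by simp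
    also have "\<dots> = (A <#> A) <#> (B <#> B)" using sub by (simp add: set_mult_assoc set_mult_closed)
    also have "\<dots> = A <#> B"
      using A B by (simp add: set_mult_subgroup_absorb subgroup.one_closed)
    finally show ?thesis .
  qed
qed

section \<open>Trajectories of an endomorphism\<close>

locale group_endo = group G for G (structure) +
  fixes \<phi> :: "'a \<Rightarrow> 'a"
  assumes endo: "\<phi> \<in> hom G G"
begin

sublocale group_hom G G \<phi>
  using endo by unfold_locales

abbreviation T :: "'a set \<Rightarrow> nat \<Rightarrow> 'a set" where
  "T \<equiv> trajectory G \<phi>"

text \<open>The class of sets on which indices can be computed. Since T_1(F) = F, such an
  \<open>F\<close> is itself a finite subgroup. The assumptions on the group enter the proof only by
  providing enough of these sets.\<close>

definition subgroup_trajectories :: "'a set \<Rightarrow> bool" where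
  "subgroup_trajectories F \<longleftrightarrow> F \<subseteq> carrier G \<and> finite F \<and> (\<forall>n. subgroup (T F n) G)"

lemma funpow_hom: "\<phi> ^^ n \<in> hom G G"
proof (induction n)
  case (Suc n)
  then show ?case using endo by (fastforce simp: hom_def Pi_iff)
qed (auto simp: hom_def)

lemma funpow_one: "(\<phi> ^^ n) \<one> = \<one>"
  by (induction n) auto

lemma funpow_carrier: "X \<subseteq> carrier G \<Longrightarrow> (\<phi> ^^ n) ` X \<subseteq> carrier G"
  using funpow_hom[of n] by (auto simp: hom_def)

lemma image_carrier: "X \<subseteq> carrier G \<Longrightarrow> \<phi> ` X \<subseteq> carrier G"
  using funpow_carrier[of X 1] by simp

lemma trajectory_carrier: "X \<subseteq> carrier G \<Longrightarrow> T X n \<subseteq> carrier G"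
  by (induction n) (simp_all add: trajectory.simps(2) set_mult_closed funpow_carrier)

lemma finite_trajectory: "finite X \<Longrightarrow> finite (T X n)"
  by (induction n) (simp_all add: trajectory.simps(2) finite_set_mult)

lemma trajectory_nonempty: "X \<noteq> {} \<Longrightarrow> T X n \<noteq> {}"
  by (induction n) (auto simp: trajectory.simps(2) set_mult_def)

lemma trajectory_mono: "X \<subseteq> Y \<Longrightarrow> T X n \<subseteq> T Y n"
  by (induction n) (simp_all add: trajectory.simps(2) mono_set_mult image_mono)

lemma trajectory_one: "X \<subseteq> carrier G \<Longrightarrow> T X (Suc 0) = X"
  by (force simp: trajectory.simps(2) set_mult_def)

text \<open>The homomorphism \<open>\<phi> ^^ m\<close> distributes over the product defining
  T_n(X). This yields subadditivity of log |T_n(X)| and, for \<open>m = 1\<close>, a recursion from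
  the left.\<close>

lemma trajectory_add:
  assumes X: "X \<subseteq> carrier G"
  shows "T X (m + n) = T X m <#> (\<phi> ^^ m) ` T X n"
proof (induction n)
  case 0
  show ?case using funpow_one[of m] trajectory_carrier[OF X, of m] by (force simp: set_mult_def)
next
  case (Suc n)
  have "T X (m + Suc n) = (T X m <#> (\<phi> ^^ m) ` T X n) <#> (\<phi> ^^ m) ` (\<phi> ^^ n) ` X"
    using Suc by (simp add: trajectory.simps(2) funpow_add image_comp)
  also have "\<dots> = T X m <#> ((\<phi> ^^ m) ` T X n <#> (\<phi> ^^ m) ` (\<phi> ^^ n) ` X)"
    using X by (intro set_mult_assoc funpow_carrier trajectory_carrier)
  also have "(\<phi> ^^ m) ` T X n <#> (\<phi> ^^ m) ` (\<phi> ^^ n) ` X = (\<phi> ^^ m) ` T X (Suc n)"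
    using X by (simp add: trajectory.simps(2) set_mult_hom[OF funpow_hom] trajectory_carrier funpow_carrier)
  finally show ?case .
qed

lemma trajectory_Suc_left: "X \<subseteq> carrier G \<Longrightarrow> T X (Suc n) = X <#> \<phi> ` T X n"
  using trajectory_add[of X 1 n] trajectory_one[of X] by simp

lemma card_trajectory_pos: "finite X \<Longrightarrow> X \<noteq> {} \<Longrightarrow> 0 < card (T X n)"
  by (simp add: card_gt_0_iff finite_trajectory trajectory_nonempty)

text \<open>By \<open>trajectory_add\<close>, log |T_n(X)| is subadditive, so the \<open>lim\<close>
  in the definition of \<open>entropy_wrt\<close> is a genuine limit.\<close>

lemma entropy_wrt_LIMSEQ:
  assumes X: "X \<subseteq> carrier G" "finite X" "X \<noteq> {}"
  shows "(\<lambda>n. ln (real (card (T X n))) / n) \<longlonglongrightarrow> entropy_wrt G \<phi> X"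
proof -
  note pos = card_trajectory_pos[OF X(2,3)]
  have "convergent (\<lambda>n. ln (real (card (T X n))) / n)"
  proof (rule convergent_subadditive)
    show "0 \<le> ln (real (card (T X n)))" for n using pos[of n] by simp
    fix m n
    have "card (T X (m + n)) \<le> card (T X m) * card ((\<phi> ^^ m) ` T X n)"
      unfolding trajectory_add[OF X(1)]
      by (intro card_set_mult_le finite_imageI finite_trajectory X)
    also have "\<dots> \<le> card (T X m) * card (T X n)"
      by (intro mult_le_mono2 card_image_le finite_trajectory X)
    finally have "real (card (T X (m + n))) \<le> real (card (T X m)) * real (card (T X n))"
      by (metis of_nat_le_iff of_nat_mult)
    then have "ln (real (card (T X (m + n)))) \<le> ln (real (card (T X m)) * real (card (T X n)))"
      using pos[of "m + n"] pos[of m] pos[of n] by (subst ln_le_cancel_iff) auto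
    then show "ln (real (card (T X (m + n)))) \<le> ln (real (card (T X m))) + ln (real (card (T X n)))"
      using pos[of m] pos[of n] by (simp add: ln_mult)
  qed
  then show ?thesis by (simp add: entropy_wrt_def convergent_LIMSEQ_iff)
qed

lemma entropy_wrt_nonneg:
  assumes X: "X \<subseteq> carrier G" "finite X" "X \<noteq> {}"
  shows "0 \<le> entropy_wrt G \<phi> X"
proof (rule LIMSEQ_le_const[OF entropy_wrt_LIMSEQ[OF X]])
  have "0 \<le> ln (real (card (T X n))) / n" for n
    using card_trajectory_pos[OF X(2,3), of n] by simp
  then show "\<exists>N. \<forall>n\<ge>N. 0 \<le> ln (real (card (T X n))) / n" by blast
qed

lemma entropy_wrt_mono:
  assumes X: "X \<noteq> {}" "X \<subseteq> Y" and Y: "Y \<subseteq> carrier G" "finite Y"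
  shows "entropy_wrt G \<phi> X \<le> entropy_wrt G \<phi> Y"
proof (rule LIMSEQ_le)
  have finX: "finite X" using X Y finite_subset by blast
  show "(\<lambda>n. ln (real (card (T X n))) / n) \<longlonglongrightarrow> entropy_wrt G \<phi> X"
    using X Y finX by (intro entropy_wrt_LIMSEQ) auto
  show "(\<lambda>n. ln (real (card (T Y n))) / n) \<longlonglongrightarrow> entropy_wrt G \<phi> Y"
    using X Y by (intro entropy_wrt_LIMSEQ) auto
  have "card (T X n) \<le> card (T Y n)" for n
    using X Y by (intro card_mono finite_trajectory trajectory_mono)
  then show "\<exists>N. \<forall>n\<ge>N. ln (real (card (T X n))) / n \<le> ln (real (card (T Y n))) / n"
    using card_trajectory_pos[OF finX X(1)] by (auto intro!: divide_right_mono ln_mono exI[of _ 0])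
qed

text \<open>As \<open>F\<close> contains the unit, the last factor of T_n(F) phi^n(F) and the first
  factor of F phi(T_n(F)) may be taken trivial.\<close>

lemma subgroup_trajectories_mono_Suc:
  assumes F: "subgroup_trajectories F" "F \<noteq> {}"
  shows "T F n \<subseteq> T F (Suc n)" and "\<phi> ` T F n \<subseteq> T F (Suc n)"
proof -
  have sub: "F \<subseteq> carrier G" "subgroup (T F n) G" for n
    using F unfolding subgroup_trajectories_def by auto
  have F1: "\<one> \<in> F" using subgroup.one_closed[OF sub(2)[of "Suc 0"]] trajectory_one[OF sub(1)] by simp
  have carr: "T F n \<subseteq> carrier G" "\<phi> ` T F n \<subseteq> carrier G"
    using trajectory_carrier[OF sub(1)] by (simp_all add: image_carrier)
  have "\<one> \<in> (\<phi> ^^ n) ` F" using F1 funpow_one by (metis image_eqI)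
  then have "x \<otimes> \<one> \<in> T F (Suc n)" if "x \<in> T F n" for x
    using that by (simp add: trajectory.simps(2) set_multI)
  then show "T F n \<subseteq> T F (Suc n)" using carr by (metis r_one subset_iff)
  have "\<one> \<otimes> y \<in> T F (Suc n)" if "y \<in> \<phi> ` T F n" for y
    using that F1 sub by (simp add: trajectory_Suc_left set_multI)
  then show "\<phi> ` T F n \<subseteq> T F (Suc n)" using carr by (metis l_one subset_iff)
qed

text \<open>Writes T_(n+2) as a product of a subgroup with its own image, the form that
  \<open>card_set_mult_image\<close> counts. The new factor phi^(n+1)(F) lies in phi(T_(n+1));
  conversely both factors lie in the subgroup T_(n+2).\<close>

lemma subgroup_trajectories_Suc_Suc:
  assumes F: "subgroup_trajectories F" "F \<noteq> {}"
  shows "T F (Suc (Suc n)) = T F (Suc n) <#> \<phi> ` T F (Suc n)"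
proof
  have sub: "F \<subseteq> carrier G" "subgroup (T F n) G" for n
    using F unfolding subgroup_trajectories_def by auto
  note mono = subgroup_trajectories_mono_Suc[OF F]
  have "\<one> \<in> T F n" using sub by (simp add: subgroup.one_closed)
  have "(\<phi> ^^ n) ` F \<subseteq> T F (Suc n)"
  proof
    fix y assume "y \<in> (\<phi> ^^ n) ` F"
    then have "\<one> \<otimes> y \<in> T F (Suc n)" using \<open>\<one> \<in> T F n\<close> by (simp add: trajectory.simps(2) set_multI)
    moreover have "y \<in> carrier G" using \<open>y \<in> _\<close> funpow_carrier[OF sub(1)] by blast
    ultimately show "y \<in> T F (Suc n)" by simp
  qed
  then have "(\<phi> ^^ Suc n) ` F \<subseteq> \<phi> ` T F (Suc n)" by (auto simp: image_comp[symmetric])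
  then show "T F (Suc (Suc n)) \<subseteq> T F (Suc n) <#> \<phi> ` T F (Suc n)"
    by (subst trajectory.simps(2)) (intro mono_set_mult order_refl)
  have "T F (Suc n) <#> \<phi> ` T F (Suc n) \<subseteq> T F (Suc (Suc n)) <#> T F (Suc (Suc n))"
    by (intro mono_set_mult mono)
  also have "\<dots> = T F (Suc (Suc n))"
    using sub by (intro set_mult_subgroup_absorb order_refl subgroup.one_closed)
  finally show "T F (Suc n) <#> \<phi> ` T F (Suc n) \<subseteq> T F (Suc (Suc n))" .
qed

text \<open>Let \<open>\<alpha> n\<close> be the index of T_n in T_(n+1) and \<open>D n\<close> the
  set on the left. Counting T_(n+2) = T_(n+1) phi(T_(n+1)) gives
  \<open>\<alpha> (Suc n) * card (D n) = \<alpha> n * card (T F n)\<close>. Since T_n is contained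
  in \<open>D n\<close>, the indices decrease; once they are constant, the inclusion is an
  equality.\<close>

lemma trajectory_index_stationary:
  assumes F: "subgroup_trajectories F" "F \<noteq> {}"
  shows "\<exists>N. \<forall>n\<ge>N. {b \<in> T F (Suc n). \<phi> b \<in> T F (Suc n)} = T F n"
proof -
  have sub: "finite F" "subgroup (T F n) G" for n
    using F unfolding subgroup_trajectories_def by auto
  note mono = subgroup_trajectories_mono_Suc[OF F]
  define D where "D = (\<lambda>n. {b \<in> T F (Suc n). \<phi> b \<in> T F (Suc n)})"
  define \<alpha> where "\<alpha> = (\<lambda>n. card (T F (Suc n)) div card (T F n))"
  have pos: "0 < card (T F n)" for n using F sub by (intro card_trajectory_pos)
  \<comment> \<open>By Lagrange's theorem the division defining \<open>\<alpha>\<close> is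
    exact.\<close>
  have index: "card (T F (Suc n)) = \<alpha> n * card (T F n)" for n
  proof -
    have "subgroup (T F n) (G\<lparr>carrier := T F (Suc n)\<rparr>)"
      using mono sub by (intro subgroup_incl)
    then have "card (rcosets\<^bsub>G\<lparr>carrier := T F (Suc n)\<rparr>\<^esub> T F n) * card (T F n) = card (T F (Suc n))"
      using group.lagrange[OF subgroup_imp_group[OF sub(2)[of "Suc n"]], of "T F n"]
      by (simp add: order_def)
    then have "card (T F n) dvd card (T F (Suc n))" by (metis dvd_triv_right)
    then show ?thesis unfolding \<alpha>_def by simp
  qed
  have TD: "T F n \<subseteq> D n" for n using mono[of n] unfolding D_def by auto
  have finD: "finite (D n)" for n
    unfolding D_def using finite_trajectory[OF sub(1)] by (metis finite_Collect_conjI Collect_mem_eq)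
  have D: "\<alpha> (Suc n) * card (D n) = \<alpha> n * card (T F n)" for n
  proof -
    have "card (T F (Suc (Suc n))) * card (D n) = card (T F (Suc n)) * card (T F (Suc n))"
      unfolding subgroup_trajectories_Suc_Suc[OF F] D_def
      by (intro card_set_mult_image sub finite_trajectory)
    then show ?thesis using pos[of "Suc n"] by (simp add: index)
  qed
  have "\<alpha> (Suc n) \<le> \<alpha> n" for n
  proof -
    have "\<alpha> (Suc n) * card (T F n) \<le> \<alpha> (Suc n) * card (D n)"
      using TD finD by (intro mult_le_mono2 card_mono)
    also note D
    finally show ?thesis using pos[of n] by simp
  qed
  then obtain N where N: "\<alpha> n = \<alpha> N" if "n \<ge> N" for n
    using decseq_nat_stationary[of \<alpha>] decseq_SucI[of \<alpha>] by blast
  have "D n = T F n" if "n \<ge> N" for n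
  proof -
    have "\<alpha> (Suc n) = \<alpha> n" using N[of n] N[of "Suc n"] that by simp
    moreover have "\<alpha> n > 0" using index[of n] pos[of "Suc n"] by (cases "\<alpha> n = 0") auto
    ultimately have "card (D n) = card (T F n)" using D[of n] by simp
    then show ?thesis using card_subset_eq[OF finD TD] by metis
  qed
  then show ?thesis unfolding D_def by blast
qed

end

section \<open>Image and kernel parts of a trajectory under a semiconjugacy\<close>

text \<open>Abstracts the projection from G to G/H: \<open>f\<close> intertwines the two
  endomorphisms, and its kernel stands for H.\<close>

locale semiconjugacy =
  dom: group_endo G \<phi> + cod: group_endo K \<psi> + hom: group_hom G K f
  for G (structure) and \<phi> and K (structure) and \<psi> and f +
  assumes semiconj: "x \<in> carrier G \<Longrightarrow> f (\<phi> x) = \<psi> (f x)"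
begin

lemma semiconj_funpow: "x \<in> carrier G \<Longrightarrow> f ((\<phi> ^^ n) x) = (\<psi> ^^ n) (f x)"
proof (induction n)
  case (Suc n)
  then have "(\<phi> ^^ n) x \<in> carrier G" using dom.funpow_carrier[of "{x}" n] by simp
  with Suc semiconj show ?case by simp
qed simp

lemma image_trajectory:
  assumes X: "X \<subseteq> carrier G"
  shows "f ` trajectory G \<phi> X n = trajectory K \<psi> (f ` X) n"
proof (induction n)
  case (Suc n)
  have "f ` (\<phi> ^^ n) ` X = (\<psi> ^^ n) ` f ` X"
    unfolding image_image using X by (intro image_cong refl semiconj_funpow) blast
  then show ?case
    using X Suc
    by (simp add: trajectory.simps(2) set_mult_hom[OF hom.homh] dom.trajectory_carrier dom.funpow_carrier)
qed simp

lemma subgroup_trajectories_image: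
  assumes "dom.subgroup_trajectories F"
  shows "cod.subgroup_trajectories (f ` F)"
proof -
  have F: "F \<subseteq> carrier G" "finite F" "subgroup (trajectory G \<phi> F n) G" for n
    using assms unfolding dom.subgroup_trajectories_def by auto
  have "subgroup (trajectory K \<psi> (f ` F) n) K" for n
    using hom.subgroup_img_is_subgroup[OF F(3)] by (simp add: image_trajectory[OF F(1)])
  then show ?thesis
    unfolding cod.subgroup_trajectories_def using F by auto
qed

text \<open>The homomorphism theorem for \<open>f\<close> on the subgroup T_n(F), obtained from
  \<open>card_set_mult_image\<close> with the trivial subgroup as first factor.\<close>

lemma card_trajectory_split:
  assumes "dom.subgroup_trajectories F"
  shows "card (trajectory G \<phi> F n) =
    card (trajectory K \<psi> (f ` F) n) * card (trajectory G \<phi> F n \<inter> kernel G K f)"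
proof -
  have F: "F \<subseteq> carrier G" "finite F" "subgroup (trajectory G \<phi> F n) G" for n
    using assms unfolding dom.subgroup_trajectories_def by auto
  have carr: "f ` trajectory G \<phi> F n \<subseteq> carrier K"
    using dom.trajectory_carrier[OF F(1)] by (auto simp: subset_iff)
  then have "{\<one>\<^bsub>K\<^esub>} <#>\<^bsub>K\<^esub> f ` trajectory G \<phi> F n = f ` trajectory G \<phi> F n"
    by (force simp: set_mult_def)
  moreover have "{b \<in> trajectory G \<phi> F n. f b \<in> {\<one>\<^bsub>K\<^esub>}} = trajectory G \<phi> F n \<inter> kernel G K f"
    using dom.trajectory_carrier[OF F(1)] by (auto simp: kernel_def)
  ultimately show ?thesis
    using hom.card_set_mult_image[of "{\<one>\<^bsub>K\<^esub>}" "trajectory G \<phi> F n"] F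
    by (simp add: dom.finite_trajectory cod.triv_subgroup image_trajectory)
qed

text \<open>In \<open>x = a \<phi>(b)\<close> the hypothesis on \<open>n\<close> lets us replace \<open>b\<close> by its \<open>kernel\<close>-part: it gives
  \<open>c \<in> T\<^sub>n(F)\<close> with \<open>f c = f b\<close>, and then \<open>\<phi>(c)\<close> can be absorbed into \<open>a\<close>.\<close>

lemma kernel_trajectory_Suc:
  assumes F: "dom.subgroup_trajectories F" "F \<noteq> {}"
    and n: "{b \<in> trajectory K \<psi> (f ` F) (Suc n). \<psi> b \<in> trajectory K \<psi> (f ` F) (Suc n)} =
      trajectory K \<psi> (f ` F) n"
  defines "E \<equiv> trajectory G \<phi> F (Suc n) \<inter> kernel G K f"
  shows "trajectory G \<phi> F (Suc (Suc n)) \<inter> kernel G K f = E <#> \<phi> ` E"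
proof
  have sub: "F \<subseteq> carrier G" "subgroup (dom.T F m) G" for m
    using F unfolding dom.subgroup_trajectories_def by auto
  have inT: "x \<in> dom.T F m \<Longrightarrow> x \<in> carrier G" for x m using sub(2) by (rule subgroup.mem_carrier)
  note clo = subgroup.m_closed[OF sub(2)] subgroup.m_inv_closed[OF sub(2)]
  note mono = dom.subgroup_trajectories_mono_Suc[OF F]
  show "dom.T F (Suc (Suc n)) \<inter> kernel G K f \<subseteq> E <#> \<phi> ` E"
  proof
    fix x assume x: "x \<in> dom.T F (Suc (Suc n)) \<inter> kernel G K f"
    then obtain a b where ab: "a \<in> dom.T F (Suc n)" "b \<in> dom.T F (Suc n)" "x = a \<otimes> \<phi> b"
      unfolding dom.subgroup_trajectories_Suc_Suc[OF F] by (auto elim!: set_multE)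
    have car: "a \<in> carrier G" "b \<in> carrier G" using ab inT by auto
    \<comment> \<open>As \<open>x\<close> is in the kernel, \<open>\<psi>\<close> sends
      \<open>f b\<close> to the inverse of \<open>f a\<close>, which stays in T_(n+1)(f F). So
      \<open>f b\<close> lies in the set of the hypothesis on \<open>n\<close>.\<close>
    have "f a \<otimes>\<^bsub>K\<^esub> \<psi> (f b) = \<one>\<^bsub>K\<^esub>"
      using x ab car by (simp add: kernel_def semiconj)
    then have "\<psi> (f b) = inv\<^bsub>K\<^esub> (f a)"
      using car by (metis cod.inv_equality cod.inv_inv cod.hom_closed cod.inv_closed hom.hom_closed cod.inv_comm)
    also have "\<dots> = f (inv a)" using car by simp
    also have "\<dots> \<in> cod.T (f ` F) (Suc n)"
      using ab clo image_trajectory[OF sub(1), of "Suc n"] by blast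
    finally have "f b \<in> cod.T (f ` F) n"
      using ab image_trajectory[OF sub(1), of "Suc n"] n by blast
    then obtain c where c: "c \<in> dom.T F n" "f c = f b"
      using image_trajectory[OF sub(1), of n] by (metis imageE)
    \<comment> \<open>It matters that \<open>c\<close> lies in T_n and not merely in T_(n+1): only
      so is \<open>\<phi> c\<close> still in T_(n+1).\<close>
    have c': "c \<in> carrier G" "c \<in> dom.T F (Suc n)" "\<phi> c \<in> dom.T F (Suc n)"
      using c mono inT by blast+
    define h where "h = inv c \<otimes> b"
    have h: "h \<in> E"
      unfolding E_def h_def kernel_def using c c' ab car clo by auto
    have hc: "h \<in> carrier G" unfolding h_def using c' car by simp
    have "c \<otimes> h = b" unfolding h_def using c' car by (simp flip: dom.m_assoc)
    then have "\<phi> b = \<phi> c \<otimes> \<phi> h" using c' hc by (metis dom.hom_mult)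
    then have eq: "x = (a \<otimes> \<phi> c) \<otimes> \<phi> h"
      using ab(3) car c' hc by (simp add: dom.m_assoc)
    have aT: "a \<otimes> \<phi> c \<in> dom.T F (Suc n)" using ab c' clo by blast
    \<comment> \<open>The kernel is invariant under \<open>\<phi>\<close> by semiconjugacy, so with
      \<open>x\<close> and \<open>\<phi> h\<close> the first factor is in the kernel too.\<close>
    have "f (\<phi> h) = \<one>\<^bsub>K\<^esub>" using h hc unfolding E_def kernel_def by (simp add: semiconj)
    moreover have "f ((a \<otimes> \<phi> c) \<otimes> \<phi> h) = \<one>\<^bsub>K\<^esub>" using x eq unfolding kernel_def by simp
    ultimately have "f (a \<otimes> \<phi> c) = \<one>\<^bsub>K\<^esub>" using car c' hc by simp
    then have "a \<otimes> \<phi> c \<in> E" using aT inT unfolding E_def kernel_def by simp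
    with h eq show "x \<in> E <#> \<phi> ` E" by (simp add: set_multI)
  qed
  show "E <#> \<phi> ` E \<subseteq> dom.T F (Suc (Suc n)) \<inter> kernel G K f"
  proof
    fix x assume "x \<in> E <#> \<phi> ` E"
    then obtain a b where ab: "a \<in> E" "b \<in> E" "x = a \<otimes> \<phi> b" by (auto elim!: set_multE)
    have "x \<in> dom.T F (Suc (Suc n))"
      using ab clo(1)[of a "Suc (Suc n)" "\<phi> b"] mono[of "Suc n"] by (auto simp: E_def)
    moreover have "f x = \<one>\<^bsub>K\<^esub>"
      using ab inT by (auto simp: E_def kernel_def semiconj)
    ultimately show "x \<in> dom.T F (Suc (Suc n)) \<inter> kernel G K f"
      using inT by (auto simp: kernel_def)
  qed
qed

lemma kernel_trajectory:
  assumes F: "dom.subgroup_trajectories F" "F \<noteq> {}"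
  obtains M where "M > 0"
    and "\<And>k. trajectory G \<phi> F (M + k) \<inter> kernel G K f =
      trajectory G \<phi> (trajectory G \<phi> F M \<inter> kernel G K f) (Suc k)"
proof -
  have sub: "F \<subseteq> carrier G" "subgroup (dom.T F m) G" for m
    using F unfolding dom.subgroup_trajectories_def by auto
  obtain N where N: "\<And>n. n \<ge> N \<Longrightarrow>
      {b \<in> trajectory K \<psi> (f ` F) (Suc n). \<psi> b \<in> trajectory K \<psi> (f ` F) (Suc n)} =
      trajectory K \<psi> (f ` F) n"
    using cod.trajectory_index_stationary[OF subgroup_trajectories_image[OF F(1)]] F(2) by blast
  \<comment> \<open>\<open>M\<close> is \<open>Suc N\<close>, because
    \<open>kernel_trajectory_Suc\<close> at \<open>n\<close> leads from length \<open>n + 1\<close>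
    to length \<open>n + 2\<close>.\<close>
  define E where "E = dom.T F (Suc N) \<inter> kernel G K f"
  have subker: "subgroup (dom.T F m \<inter> kernel G K f) G" for m
    using sub hom.subgroup_kernel by (intro dom.subgroups_Inter_pair)
  have E: "E \<subseteq> carrier G" "\<one> \<in> E"
    using subker[of "Suc N"] unfolding E_def by (rule subgroup.subset, rule subgroup.one_closed)
  have "dom.T F (Suc N + k) \<inter> kernel G K f = dom.T E (Suc k)" for k
  proof (induction k)
    case 0
    show ?case using dom.trajectory_one[OF E(1)] E_def by simp
  next
    case (Suc k)
    let ?S = "dom.T E (Suc k)"
    \<comment> \<open>That T_(k+1)(E) is a subgroup is read off from the induction hypothesis, which
      makes it an intersection of subgroups.\<close>
    have S: "subgroup ?S G" using subker[of "Suc N + k"] Suc by simp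
    have T_one: "\<one> \<in> dom.T E m" for m
    proof (induction m)
      case (Suc m)
      have "\<one> \<otimes> \<one> \<in> dom.T E m <#> (\<phi> ^^ m) ` E"
        using Suc E(2) dom.funpow_one by (intro set_multI) (auto intro!: image_eqI[of _ _ \<one>])
      then show ?case by (simp add: trajectory.simps(2))
    qed simp
    have carr: "\<phi> ` dom.T E k \<subseteq> carrier G" "\<phi> ` (\<phi> ^^ k) ` E \<subseteq> carrier G"
      using E by (intro dom.image_carrier dom.trajectory_carrier dom.funpow_carrier; simp)+
    have "\<phi> ` dom.T E k \<subseteq> ?S"
    proof
      fix y assume y: "y \<in> \<phi> ` dom.T E k"
      then have "\<one> \<otimes> y \<in> E <#> \<phi> ` dom.T E k" using E by (intro set_multI)
      then show "y \<in> ?S"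
        using y carr dom.trajectory_Suc_left[OF E(1), of k] by auto
    qed
    then have absorb: "?S <#> \<phi> ` dom.T E k = ?S"
      using S T_one dom.hom_one by (intro dom.set_mult_subgroup_absorb) (auto intro!: image_eqI[of _ _ \<one>])
    \<comment> \<open>In S phi(S) with S = T_(k+1)(E), split phi(S) into phi(T_k(E)), which
      \<open>S\<close> absorbs, and the new factor phi^(k+1)(E).\<close>
    have "dom.T F (Suc N + Suc k) \<inter> kernel G K f = ?S <#> \<phi> ` ?S"
      using kernel_trajectory_Suc[OF F N[of "N + k"]] Suc by simp
    also have "\<phi> ` ?S = \<phi> ` dom.T E k <#> \<phi> ` (\<phi> ^^ k) ` E"
      using E by (simp add: trajectory.simps(2)[of _ _ _ k] set_mult_hom[OF dom.endo] dom.trajectory_carrier dom.funpow_carrier)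
    also have "?S <#> \<dots> = (?S <#> \<phi> ` dom.T E k) <#> \<phi> ` (\<phi> ^^ k) ` E"
      using carr subgroup.subset[OF S] by (intro dom.set_mult_assoc[symmetric])
    also have "\<dots> = dom.T E (Suc (Suc k))"
      unfolding absorb by (simp add: trajectory.simps(2)[of _ _ _ "Suc k"] image_comp o_def)
    finally show ?case .
  qed
  then show ?thesis using that[of "Suc N"] E_def by blast
qed

text \<open>Combining \<open>card_trajectory_split\<close> with \<open>kernel_trajectory\<close>
  gives |T_(M+k)(F)| = |T_(M+k)(f F)| |T_(k+1)(E)|. Take logarithms, divide by k + 1 and let k
  grow.\<close>

lemma entropy_wrt_eq_image_plus_kernel:
  assumes F: "dom.subgroup_trajectories F" "F \<noteq> {}"
  obtains E where "E \<subseteq> kernel G K f" "finite E" "E \<noteq> {}"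
    "entropy_wrt G \<phi> F = entropy_wrt K \<psi> (f ` F) + entropy_wrt G \<phi> E"
proof -
  have sub: "F \<subseteq> carrier G" "finite F" "subgroup (dom.T F m) G" for m
    using F unfolding dom.subgroup_trajectories_def by auto
  obtain M where M: "M > 0" and ker: "\<And>k. dom.T F (M + k) \<inter> kernel G K f =
      dom.T (dom.T F M \<inter> kernel G K f) (Suc k)"
    using kernel_trajectory[OF F] by blast
  define E where "E = dom.T F M \<inter> kernel G K f"
  have "\<one> \<in> E"
    unfolding E_def using sub hom.subgroup_kernel by (auto simp: subgroup.one_closed)
  then have E: "E \<subseteq> carrier G" "finite E" "E \<noteq> {}"
    unfolding E_def using dom.trajectory_carrier[OF sub(1)] sub(2) by (auto simp: dom.finite_trajectory)
  have fF: "f ` F \<subseteq> carrier K" "finite (f ` F)" "f ` F \<noteq> {}" using sub F by auto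
  have split: "ln (card (dom.T F (M + k))) / Suc k =
      ln (card (cod.T (f ` F) (M + k))) / Suc k + ln (card (dom.T E (Suc k))) / Suc k" for k
  proof -
    have "card (dom.T F (M + k)) = card (cod.T (f ` F) (M + k)) * card (dom.T E (Suc k))"
      using card_trajectory_split[OF F(1), of "M + k"] ker[of k] unfolding E_def by simp
    then show ?thesis
      using cod.card_trajectory_pos[OF fF(2,3), of "M + k"] dom.card_trajectory_pos[OF E(2,3), of "Suc k"]
      by (simp add: ln_mult add_divide_distrib)
  qed
  have "(\<lambda>k. ln (card (dom.T F (M + k))) / Suc k) \<longlonglongrightarrow> entropy_wrt G \<phi> F"
    using dom.entropy_wrt_LIMSEQ[OF sub(1,2) F(2)] M by (rule LIMSEQ_divide_shift)
  moreover have "(\<lambda>k. ln (card (dom.T F (M + k))) / Suc k)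
      \<longlonglongrightarrow> entropy_wrt K \<psi> (f ` F) + entropy_wrt G \<phi> E"
    unfolding split
    by (intro tendsto_add LIMSEQ_divide_shift[OF cod.entropy_wrt_LIMSEQ[OF fF] M]
        LIMSEQ_Suc[OF dom.entropy_wrt_LIMSEQ[OF E]])
  ultimately have "entropy_wrt G \<phi> F = entropy_wrt K \<psi> (f ` F) + entropy_wrt G \<phi> E"
    by (rule LIMSEQ_unique)
  then show ?thesis using that E E_def by blast
qed

text \<open>T_n(X) lies in the kernel part of T_n(F), so \<open>card_trajectory_split\<close> yields
  |T_n(f F)| |T_n(X)| \<le> |T_n(F)|.\<close>

lemma entropy_wrt_image_plus_kernel_le:
  assumes F: "dom.subgroup_trajectories F"
    and X: "X \<subseteq> F \<inter> kernel G K f" "X \<noteq> {}"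
  shows "entropy_wrt K \<psi> (f ` F) + entropy_wrt G \<phi> X \<le> entropy_wrt G \<phi> F"
proof -
  have sub: "F \<subseteq> carrier G" "finite F" "subgroup (dom.T F m) G" for m
    using F unfolding dom.subgroup_trajectories_def by auto
  have ne: "F \<noteq> {}" using X by auto
  have finX: "finite X" "X \<subseteq> carrier G" using X sub finite_subset by auto
  have fF: "f ` F \<subseteq> carrier K" "finite (f ` F)" "f ` F \<noteq> {}" using sub ne by auto
  have Xker: "f ` dom.T X n \<subseteq> {\<one>\<^bsub>K\<^esub>}" for n
  proof -
    have "f ` X \<subseteq> {\<one>\<^bsub>K\<^esub>}" using X by (auto simp: kernel_def)
    then have "cod.T (f ` X) n \<subseteq> cod.T {\<one>\<^bsub>K\<^esub>} n" by (rule cod.trajectory_mono)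
    also have "cod.T {\<one>\<^bsub>K\<^esub>} n = {\<one>\<^bsub>K\<^esub>}"
      by (induction n) (auto simp: trajectory.simps(2) set_mult_def cod.funpow_one)
    finally show ?thesis using image_trajectory finX by simp
  qed
  have le: "ln (card (cod.T (f ` F) n)) / n + ln (card (dom.T X n)) / n \<le> ln (card (dom.T F n)) / n" for n
  proof -
    have "dom.T X n \<subseteq> dom.T F n \<inter> kernel G K f"
      using Xker[of n] dom.trajectory_mono[of X F n] X dom.trajectory_carrier[OF finX(2), of n]
      by (auto simp: kernel_def)
    then have "card (dom.T X n) \<le> card (dom.T F n \<inter> kernel G K f)"
      using sub by (intro card_mono) (auto simp: dom.finite_trajectory)
    then have "card (cod.T (f ` F) n) * card (dom.T X n) \<le> card (dom.T F n)"
      using card_trajectory_split[OF F, of n] by simp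
    then have "real (card (cod.T (f ` F) n)) * real (card (dom.T X n)) \<le> real (card (dom.T F n))"
      by (metis of_nat_le_iff of_nat_mult)
    moreover note pos = cod.card_trajectory_pos[OF fF(2,3), of n] dom.card_trajectory_pos[OF finX(1) X(2), of n]
    ultimately have "ln (real (card (cod.T (f ` F) n)) * real (card (dom.T X n))) \<le> ln (real (card (dom.T F n)))"
      using dom.card_trajectory_pos[OF sub(2) ne, of n] by (subst ln_le_cancel_iff) auto
    then have "ln (card (cod.T (f ` F) n)) + ln (card (dom.T X n)) \<le> ln (card (dom.T F n))"
      using pos by (simp add: ln_mult)
    then show ?thesis by (simp add: divide_right_mono flip: add_divide_distrib)
  qed
  show ?thesis
    by (rule LIMSEQ_le[OF tendsto_add[OF cod.entropy_wrt_LIMSEQ[OF fF] dom.entropy_wrt_LIMSEQ[OF finX(2,1) X(2)]]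
          dom.entropy_wrt_LIMSEQ[OF sub(1,2) ne]]) (use le in blast)
qed

end

section \<open>Finite subgroups whose trajectories are subgroups\<close>

text \<open>The conjugates of elements of \<open>X\<close> form a finite set, closed under
  conjugation, so they generate a finite normal subgroup \<open>F\<close>. In the recursion F
  phi(T_n(F)) from the left the first factor is normal, hence the product is a subgroup.\<close>

lemma (in group_endo) FC_subgroup_trajectories:
  assumes lf: "locally_finite_group G" and FC: "FC_group G" and X: "X \<subseteq> carrier G" "finite X"
  obtains F where "X \<subseteq> F" "subgroup_trajectories F"
proof -
  define S where "S = (\<Union>x\<in>X. {g \<otimes> x \<otimes> inv g | g. g \<in> carrier G})"
  have S: "S \<subseteq> carrier G" "finite S" using X FC unfolding S_def FC_group_def by auto
  define F where "F = generate G S"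
  have "X \<subseteq> S"
  proof
    fix x assume x: "x \<in> X"
    then have "x = \<one> \<otimes> x \<otimes> inv \<one>" using X by auto
    then show "x \<in> S" using x unfolding S_def by blast
  qed
  then have XF: "X \<subseteq> F" unfolding F_def by (blast intro: generate.incl)
  have N: "F \<lhd> G"
    unfolding F_def
  proof (rule normal_generateI[OF S(1)])
    fix h g assume h: "h \<in> S" and g: "g \<in> carrier G"
    then obtain x k where x: "x \<in> X" "k \<in> carrier G" "h = k \<otimes> x \<otimes> inv k" unfolding S_def by auto
    then have "g \<otimes> h \<otimes> inv g = (g \<otimes> k) \<otimes> x \<otimes> inv (g \<otimes> k)"
      using X g by (simp add: m_assoc inv_mult_group subsetD)
    then show "g \<otimes> h \<otimes> inv g \<in> S" using x g unfolding S_def by blast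
  qed
  have F: "F \<subseteq> carrier G" using normal_imp_subgroup[OF N] by (rule subgroup.subset)
  have "subgroup (T F n) G" for n
  proof (induction n)
    case (Suc n)
    then show ?case
      unfolding trajectory_Suc_left[OF F] by (intro mult_norm_subgroup N subgroup_img_is_subgroup)
  qed (simp add: triv_subgroup)
  moreover have "finite F" using lf S unfolding F_def locally_finite_group_def by blast
  ultimately show ?thesis using that XF F unfolding subgroup_trajectories_def by blast
qed

text \<open>The finite subgroup generated by \<open>X\<close> suffices, since it permutes with the
  subgroup phi(T_n(F)).\<close>

lemma (in group_endo) quasihamiltonian_subgroup_trajectories:
  assumes lf: "locally_finite_group G" and qh: "quasihamiltonian_group G"
    and X: "X \<subseteq> carrier G" "finite X"
  obtains F where "X \<subseteq> F" "subgroup_trajectories F"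
proof -
  define F where "F = generate G X"
  have sub: "subgroup F G" unfolding F_def using X by (intro generate_is_subgroup)
  have F: "F \<subseteq> carrier G" using sub by (rule subgroup.subset)
  have "subgroup (T F n) G" for n
  proof (induction n)
    case (Suc n)
    have "subgroup (\<phi> ` T F n) G" using Suc by (rule subgroup_img_is_subgroup)
    then show ?case
      using sub qh unfolding trajectory_Suc_left[OF F] quasihamiltonian_group_def
      by (intro subgroup_set_mult_commute) auto
  qed (simp add: triv_subgroup)
  moreover have "finite F" using lf X unfolding F_def locally_finite_group_def by blast
  moreover have "X \<subseteq> F" unfolding F_def by (blast intro: generate.incl)
  ultimately show ?thesis using that F unfolding subgroup_trajectories_def by blast
qed

section \<open>Restriction, quotient and the addition formula\<close>

text \<open>Iterates of points of \<open>H\<close> stay in \<open>H\<close>, where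
  \<open>restrict \<phi> H\<close> agrees with \<open>\<phi>\<close>; the product and the unit are
  those of \<open>G\<close>. So the trajectories coincide.\<close>

lemma entropy_wrt_restrict:
  assumes H: "X \<subseteq> H" and inv: "\<phi> ` H \<subseteq> H"
  shows "entropy_wrt (G\<lparr>carrier := H\<rparr>) (restrict \<phi> H) X = entropy_wrt G \<phi> X"
proof -
  have *: "(restrict \<phi> H ^^ n) x = (\<phi> ^^ n) x \<and> (\<phi> ^^ n) x \<in> H" if "x \<in> H" for x n
    using that inv by (induction n) auto
  then have "(restrict \<phi> H ^^ n) ` X = (\<phi> ^^ n) ` X" for n
    using H by (intro image_cong) auto
  then have "trajectory (G\<lparr>carrier := H\<rparr>) (restrict \<phi> H) X n = trajectory G \<phi> X n" for n
    by (induction n) (simp_all add: trajectory.simps(2))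
  then show ?thesis by (simp add: entropy_wrt_def)
qed

lemma quotient_map_hom:
  assumes H: "H \<lhd> G" and \<phi>: "\<phi> \<in> hom G G" and inv: "\<phi> ` H \<subseteq> H"
  shows "quotient_map_by G H \<phi> \<in> hom (G Mod H) (G Mod H)"
proof (rule homI)
  interpret normal H G by (rule H)
  note q = quotient_map_coset[OF H \<phi> inv]
  have \<phi>c: "x \<in> carrier G \<Longrightarrow> \<phi> x \<in> carrier G" for x using \<phi> by (rule hom_in_carrier)
  show "quotient_map_by G H \<phi> C \<in> carrier (G Mod H)" if "C \<in> carrier (G Mod H)" for C
    using that q \<phi>c by (auto simp: carrier_FactGroup)
  show "quotient_map_by G H \<phi> (C \<otimes>\<^bsub>G Mod H\<^esub> D) =
      quotient_map_by G H \<phi> C \<otimes>\<^bsub>G Mod H\<^esub> quotient_map_by G H \<phi> D"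
    if "C \<in> carrier (G Mod H)" "D \<in> carrier (G Mod H)" for C D
    using that q \<phi>c hom_mult[OF \<phi>] by (auto simp: carrier_FactGroup rcos_sum)
qed

theorem corollary1p5:
  fixes G :: "('a, 'b) monoid_scheme" and \<phi> :: "'a \<Rightarrow> 'a" and H :: "'a set"
  assumes "group G"
    and "locally_finite_group G"
    and "FC_group G \<or> quasihamiltonian_group G"
    and "\<phi> \<in> hom G G"
    and "H \<lhd> G"
    and "\<phi> ` H \<subseteq> H"
  shows "algebraic_entropy G \<phi> =
    algebraic_entropy (G\<lparr>carrier := H\<rparr>) (restrict \<phi> H) +
    algebraic_entropy (G Mod H) (quotient_map_by G H \<phi>)"
proof -
  interpret normal H G by (rule assms(5))
  interpret group_endo G \<phi>
    by (intro group_endo.intro group_endo_axioms.intro assms)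
  let ?\<psi> = "quotient_map_by G H \<phi>" and ?K = "G Mod H" and ?\<pi> = "\<lambda>x. H #>\<^bsub>G\<^esub> x"
  interpret K: group_endo ?K ?\<psi>
    by (intro group_endo.intro group_endo_axioms.intro factorgroup_is_group quotient_map_hom assms)
  interpret semiconjugacy G \<phi> ?K ?\<psi> ?\<pi>
    by unfold_locales (simp_all add: r_coset_hom_Mod quotient_map_coset assms)
  have ker: "kernel G ?K ?\<pi> = H"
  proof -
    have "\<And>x. x \<in> carrier G \<Longrightarrow> H #>\<^bsub>G\<^esub> x = H \<longleftrightarrow> x \<in> H"
      using coset_join1 coset_join2 is_subgroup subset by blast
    then show ?thesis using subset by (auto simp: kernel_def)
  qed
  \<comment> \<open>With monotonicity of \<open>entropy_wrt\<close> in the finite set, this allows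
    every estimate to be made on such an \<open>F\<close>.\<close>
  have cofinal: "\<exists>F. X \<subseteq> F \<and> subgroup_trajectories F" if "X \<subseteq> carrier G" "finite X" for X
    using assms(2,3) that FC_subgroup_trajectories quasihamiltonian_subgroup_trajectories by metis
  have restr: "entropy_wrt (G\<lparr>carrier := H\<rparr>) (restrict \<phi> H) X = entropy_wrt G \<phi> X" if "X \<subseteq> H" for X
    using that assms by (intro entropy_wrt_restrict)
  let ?P = "\<lambda>A. {X. X \<subseteq> A \<and> finite X \<and> X \<noteq> {}}"
  have hH: "algebraic_entropy (G\<lparr>carrier := H\<rparr>) (restrict \<phi> H) =
      (SUP X\<in>?P H. ennreal (entropy_wrt G \<phi> X))"
    unfolding algebraic_entropy_def by (intro SUP_cong) (auto simp: restr)
  have hG: "algebraic_entropy G \<phi> = (SUP X\<in>?P (carrier G). ennreal (entropy_wrt G \<phi> X))"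
    by (simp add: algebraic_entropy_def)
  have hK: "algebraic_entropy ?K ?\<psi> = (SUP Y\<in>?P (carrier ?K). ennreal (entropy_wrt ?K ?\<psi> Y))"
    by (simp add: algebraic_entropy_def)
  show ?thesis
  proof (rule antisym)
    show "algebraic_entropy G \<phi> \<le>
      algebraic_entropy (G\<lparr>carrier := H\<rparr>) (restrict \<phi> H) + algebraic_entropy ?K ?\<psi>"
      unfolding hG
    proof (rule SUP_least)
      fix X assume "X \<in> ?P (carrier G)"
      then have X: "X \<subseteq> carrier G" "finite X" "X \<noteq> {}" by auto
      obtain F where F: "X \<subseteq> F" "subgroup_trajectories F" using cofinal X by blast
      have F': "F \<subseteq> carrier G" "finite F" "F \<noteq> {}" using F X unfolding subgroup_trajectories_def by auto
      obtain E where E: "E \<subseteq> H" "finite E" "E \<noteq> {}"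
        "entropy_wrt G \<phi> F = entropy_wrt ?K ?\<psi> (?\<pi> ` F) + entropy_wrt G \<phi> E"
        using entropy_wrt_eq_image_plus_kernel[OF F(2) F'(3)] ker by metis
      \<comment> \<open>\<open>E\<close> and the image of \<open>F\<close> compete in the suprema
        for \<open>H\<close> and for the quotient, respectively.\<close>
      have \<pi>F: "?\<pi> ` F \<in> ?P (carrier ?K)" using F' by (auto simp: carrier_FactGroup)
      have "ennreal (entropy_wrt G \<phi> X) \<le> ennreal (entropy_wrt G \<phi> F)"
        using X F F' by (intro ennreal_leI entropy_wrt_mono)
      also have "\<dots> = ennreal (entropy_wrt G \<phi> E) + ennreal (entropy_wrt ?K ?\<psi> (?\<pi> ` F))"
        using E subset \<pi>F by (simp add: entropy_wrt_nonneg K.entropy_wrt_nonneg add.commute)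
      also have "\<dots> \<le> (SUP X\<in>?P H. ennreal (entropy_wrt G \<phi> X)) + algebraic_entropy ?K ?\<psi>"
        unfolding hK using E \<pi>F by (intro add_mono SUP_upper) auto
      finally show "ennreal (entropy_wrt G \<phi> X) \<le>
          algebraic_entropy (G\<lparr>carrier := H\<rparr>) (restrict \<phi> H) + algebraic_entropy ?K ?\<psi>"
        by (simp only: hH)
    qed
    have "ennreal (entropy_wrt G \<phi> X) + ennreal (entropy_wrt ?K ?\<psi> Y) \<le> algebraic_entropy G \<phi>"
      if "X \<in> ?P H" "Y \<in> ?P (carrier ?K)" for X Y
    proof -
      have X: "X \<subseteq> H" "finite X" "X \<noteq> {}" and Y: "Y \<subseteq> carrier ?K" "finite Y" "Y \<noteq> {}"
        using that by auto
      have "Y \<subseteq> ?\<pi> ` carrier G" using Y by (auto simp: carrier_FactGroup)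
      \<comment> \<open>Lifting \<open>Y\<close> to a finite subset of \<open>G\<close> lets a
        single \<open>F\<close> serve both \<open>X\<close> and \<open>Y\<close>.\<close>
      then obtain Y' where Y': "Y' \<subseteq> carrier G" "finite Y'" "Y = ?\<pi> ` Y'"
        using finite_subset_image[OF Y(2)] by blast
      obtain F where F: "X \<union> Y' \<subseteq> F" "subgroup_trajectories F"
        using cofinal[of "X \<union> Y'"] X Y' subset by auto
      have F': "F \<subseteq> carrier G" "finite F" "F \<noteq> {}" using F X unfolding subgroup_trajectories_def by auto
      have \<pi>F: "?\<pi> ` F \<in> ?P (carrier ?K)" using F' by (auto simp: carrier_FactGroup)
      have "entropy_wrt ?K ?\<psi> Y \<le> entropy_wrt ?K ?\<psi> (?\<pi> ` F)"
        using Y Y' F \<pi>F by (intro K.entropy_wrt_mono) auto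
      moreover have "entropy_wrt ?K ?\<psi> (?\<pi> ` F) + entropy_wrt G \<phi> X \<le> entropy_wrt G \<phi> F"
        using F X by (intro entropy_wrt_image_plus_kernel_le) (auto simp: ker)
      ultimately have "entropy_wrt G \<phi> X + entropy_wrt ?K ?\<psi> Y \<le> entropy_wrt G \<phi> F" by simp
      then have "ennreal (entropy_wrt G \<phi> X) + ennreal (entropy_wrt ?K ?\<psi> Y) \<le> ennreal (entropy_wrt G \<phi> F)"
        using X Y subset by (subst ennreal_plus[symmetric])
          (auto intro!: entropy_wrt_nonneg K.entropy_wrt_nonneg ennreal_leI)
      also have "\<dots> \<le> algebraic_entropy G \<phi>" unfolding hG using F' by (intro SUP_upper) auto
      finally show ?thesis .
    qed
    \<comment> \<open>The families are non-empty, as required for moving the sum inside the suprema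
      in \<open>ennreal\<close>.\<close>
    moreover have "?P H \<noteq> {}" using one_closed by (auto intro!: exI[of _ "{\<one>\<^bsub>G\<^esub>}"])
    moreover have "?P (carrier ?K) \<noteq> {}"
      using K.one_closed by (auto intro!: exI[of _ "{\<one>\<^bsub>?K\<^esub>}"])
    ultimately show "algebraic_entropy (G\<lparr>carrier := H\<rparr>) (restrict \<phi> H) + algebraic_entropy ?K ?\<psi>
        \<le> algebraic_entropy G \<phi>"
      unfolding hH hK
      by (simp add: ennreal_SUP_add_left[symmetric] ennreal_SUP_add_right SUP_le_iff)
  qed
qed

end
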